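(* Let $\Delta$ be a simplicial complex on $[n]$ with set of facets $\mathcal{F}(\Delta)=\{F_1,\dots,F_k\}$, let $i\in[n]$ and let $\phi_i:\mathbb{R}(\Delta)\to\mathbb{R}$ be an individual value for $i$. Then $\phi_i$ is a quasi-probabilistic value (with participation rate $\lambda_i$) if and only if there exist non-negative reals $P^i(F_1),\dots,P^i(F_k)$ with $\sum_{j=1}^k P^i(F_j)=1$ (a probability distribution on $\mathcal{F}(\Delta)$) such that \[\sum_{F\in\mathcal{F}_i(\Delta)}P^i(F)=\lambda_i,\] and for every $F\in\mathcal{F}_i(\Delta)$ there exists an individual classical probabilistic value $\phi_i^F$ for $i$ defined on games on the simplex $\bar F=2^F$ such that for all $v\in\mathbb{R}(\Delta)$, \[\phi_i(v)=\sum_{F\in\mathcal{F}_i(\Delta)}P^i(F)\,\phi_i^F(v|_F),\] where $v|_F$ is the restriction of $v$ to $\bar F$, i.e. $v|_F(S)=v(S)$ for all $S\subseteq F$.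
   Context: A simplicial complex $\Delta$ on $[n]$ is a family of subsets of $[n]$ closed under taking subsets. Its facets are its inclusion-maximal elements; $\mathcal{F}(\Delta)$ is the set of facets and $\mathcal{F}_i(\Delta)$ the set of facets containing $i$. A cooperative game on $\Delta$ is a function $v:\Delta\to\mathbb{R}$ with $v(\emptyset)=0$; $\mathbb{R}(\Delta)$ is the vector space of such games. The link of $i$ is $\operatorname{Lk}_\Delta(i)=\{T\in\Delta: i\notin T,\ T\cup\{i\}\in\Delta\}$. An individual value $\phi_i:\mathbb{R}(\Delta)\to\mathbb{R}$ is quasi-probabilistic (with participation rate $\lambda_i\in[0,1]$) if there are non-negative reals $\{p^i_T: T\in\operatorname{Lk}_\Delta(i)\}$ with $\sum_T p^i_T=\lambda_i$ such that $\phi_i(v)=\sum_{T\in\operatorname{Lk}_\Delta(i)}p^i_T(v(T\cup\{i\})-v(T))$ for all $v\in\mathbb{R}(\Delta)$ (equivalently, $\phi_i$ is linear, satisfies: $i$ dummy for $v$, i.e. $v(S\cup\{i\})=v(S)+v(\{i\})$ whenever $i\notin S$, $S\cup\{i\}\in\Delta$, implies $\phi_i(v)=\lambda_i v(\{i\})$; and $v$ monotone implies $\phi_i(v)\ge0$). For a finite set $F\ni i$, a (classical) probabilistic value for $i$ on $\bar F=2^F$ is a map on games $w:2^F\to\mathbb{R}$, $w(\emptyset)=0$, of the form $\phi_i^F(w)=\sum_{T\subseteq F\setminus\{i\}}q_T(w(T\cup\{i\})-w(T))$ with $q_T\ge 0$ and $\sum_T q_T=1$.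
   Formalization: The formal theorem adds the hypothesis that λ_i = 1 or some facet of Δ does not contain i; without it the claim fails, e.g. Δ = 2^{{1}}, i = 1, φ(v) = v({1})/2 has rate 1/2, but the only facet contains i, forcing total mass 1. *)

theory Defs
  imports Complex_Main "HOL-Library.FuncSet"
begin

definition simplicial_complex :: "nat \<Rightarrow> nat set set \<Rightarrow> bool" where
  "simplicial_complex n \<Delta> \<longleftrightarrow>
     \<Delta> \<subseteq> Pow {1..n} \<and> (\<forall>S\<in>\<Delta>. \<forall>T. T \<subseteq> S \<longrightarrow> T \<in> \<Delta>)"

definition facets :: "nat set set \<Rightarrow> nat set set" where
  "facets \<Delta> = {F \<in> \<Delta>. \<forall>G\<in>\<Delta>. F \<subseteq> G \<longrightarrow> G = F}"

definition facets_at :: "nat set set \<Rightarrow> nat \<Rightarrow> nat set set" where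
  "facets_at \<Delta> i = {F \<in> facets \<Delta>. i \<in> F}"

definition link :: "nat set set \<Rightarrow> nat \<Rightarrow> nat set set" where
  "link \<Delta> i = {T \<in> \<Delta>. i \<notin> T \<and> insert i T \<in> \<Delta>}"

(* Functions with domain \<Delta> are represented extensionally (equal to undefined
   outside \<Delta>), so two games agreeing on \<Delta> are equal, and v|_F is restrict v (Pow F). *)
definition games :: "nat set set \<Rightarrow> (nat set \<Rightarrow> real) set" where
  "games \<Delta> = {v \<in> \<Delta> \<rightarrow>\<^sub>E UNIV. v {} = 0}"

(* An individual value on \<Delta> is a function on games \<Delta>; only its values on that set matter. *)
definition quasi_probabilistic ::
  "nat set set \<Rightarrow> nat \<Rightarrow> real \<Rightarrow> ((nat set \<Rightarrow> real) \<Rightarrow> real) \<Rightarrow> bool" where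
  "quasi_probabilistic \<Delta> i \<rho> \<phi> \<longleftrightarrow>
     0 \<le> \<rho> \<and> \<rho> \<le> 1 \<and>
     (\<exists>p :: nat set \<Rightarrow> real.
        (\<forall>T\<in>link \<Delta> i. 0 \<le> p T) \<and>
        (\<Sum>T\<in>link \<Delta> i. p T) = \<rho> \<and>
        (\<forall>v\<in>games \<Delta>. \<phi> v = (\<Sum>T\<in>link \<Delta> i. p T * (v (insert i T) - v T))))"

definition probabilistic_on_simplex ::
  "nat set \<Rightarrow> nat \<Rightarrow> ((nat set \<Rightarrow> real) \<Rightarrow> real) \<Rightarrow> bool" where
  "probabilistic_on_simplex F i \<psi> \<longleftrightarrow>
     finite F \<and> i \<in> F \<and>
     (\<exists>q :: nat set \<Rightarrow> real.
        (\<forall>T\<in>Pow (F - {i}). 0 \<le> q T) \<and>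
        (\<Sum>T\<in>Pow (F - {i}). q T) = 1 \<and>
        (\<forall>w\<in>games (Pow F). \<psi> w = (\<Sum>T\<in>Pow (F - {i}). q T * (w (insert i T) - w T))))"

(* If every facet contains i, a probability distribution on the facets gives total mass 1
   to those containing i, so no participation rate below 1 can arise from it. *)
lemma rate_eq_1_or_facet_avoiding:
  fixes P :: "nat set \<Rightarrow> real"
  assumes "(\<Sum>F\<in>facets \<Delta>. P F) = 1" and "(\<Sum>F\<in>facets_at \<Delta> i. P F) = \<rho>"
  shows "\<rho> = 1 \<or> (\<exists>F\<in>facets \<Delta>. i \<notin> F)"
proof (rule disjCI)
  assume "\<not> (\<exists>F\<in>facets \<Delta>. i \<notin> F)"
  then have "facets_at \<Delta> i = facets \<Delta>" by (auto simp: facets_at_def)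
  with assms show "\<rho> = 1" by simp
qed

(* Quasi-probabilistic values of rate below 1 do exist in that situation: *)
lemma quasi_probabilistic_without_facet_distribution:
  defines "\<Delta> \<equiv> Pow {1::nat}" and "\<phi> \<equiv> (\<lambda>v :: nat set \<Rightarrow> real. v {1} / 2)"
  shows "simplicial_complex 1 \<Delta>" and "quasi_probabilistic \<Delta> 1 (1/2) \<phi>"
    and "\<nexists>P :: nat set \<Rightarrow> real.
           (\<Sum>F\<in>facets \<Delta>. P F) = 1 \<and> (\<Sum>F\<in>facets_at \<Delta> 1. P F) = 1/2"
proof -
  show "simplicial_complex 1 \<Delta>" by (auto simp: simplicial_complex_def \<Delta>_def)
  have l: "link \<Delta> 1 = {{}}" by (auto simp: link_def \<Delta>_def)
  show "quasi_probabilistic \<Delta> 1 (1/2) \<phi>"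
    unfolding quasi_probabilistic_def l
    by (auto simp: games_def \<phi>_def intro!: exI[of _ "\<lambda>_. 1/2"])
  have "\<forall>F\<in>facets \<Delta>. 1 \<in> F" by (auto simp: facets_def \<Delta>_def)
  then show "\<nexists>P :: nat set \<Rightarrow> real.
           (\<Sum>F\<in>facets \<Delta>. P F) = 1 \<and> (\<Sum>F\<in>facets_at \<Delta> 1. P F) = 1/2"
    using rate_eq_1_or_facet_avoiding[of _ \<Delta> 1 "1/2"] by auto
qed

end

theory Submission
  imports Defs
begin

text \<open>
  Every face T of the link of i lies, together with i, in at least one facet. Assigning each T to
  one such facet c(T) distributes the weights of a quasi-probabilistic value over the facets
  containing i: the mass collected by F is P(F), and normalising it gives a probabilistic value on
  the simplex F (if P(F) = 0, any such value will do). The missing mass 1 - \<open>\<rho>\<close> is put on a facet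
  avoiding i. Conversely, the weight of T is the sum over all facets F containing T and i of P(F)
  times the weight of T in F.
\<close>

lemma finite_simplicial_complex: "simplicial_complex n \<Delta> \<Longrightarrow> finite \<Delta>"
  unfolding simplicial_complex_def by (auto intro: finite_subset)

lemma finite_facets: "finite \<Delta> \<Longrightarrow> finite (facets \<Delta>)"
  by (simp add: facets_def)

lemma finite_facets_at: "finite \<Delta> \<Longrightarrow> finite (facets_at \<Delta> i)"
  by (simp add: facets_at_def finite_facets)

lemma face_subset_facet:
  assumes "finite \<Delta>" and "S \<in> \<Delta>"
  obtains F where "F \<in> facets \<Delta>" and "S \<subseteq> F"
proof -
  obtain F where "F \<in> \<Delta>" "S \<subseteq> F" "\<forall>G\<in>\<Delta>. F \<subseteq> G \<longrightarrow> G = F"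
    using finite_has_maximal2[OF assms] by metis
  then show thesis using that by (auto simp: facets_def)
qed

lemma facets_at_finite_set:
  assumes "simplicial_complex n \<Delta>" and "F \<in> facets_at \<Delta> i"
  shows "finite F"
  using assms by (auto simp: simplicial_complex_def facets_at_def facets_def intro: finite_subset)

text \<open>A facet is a face and the complex is closed downwards, so every marginal contribution of
  \<open>i\<close> computed inside the simplex \<open>Pow F\<close> is also one computed in
  \<open>\<Delta>\<close>.\<close>

lemma Pow_facet_subset_link:
  assumes "simplicial_complex n \<Delta>" and "F \<in> facets_at \<Delta> i"
  shows "Pow (F - {i}) \<subseteq> link \<Delta> i"
proof
  fix T assume "T \<in> Pow (F - {i})"
  then have "T \<subseteq> F" "insert i T \<subseteq> F" "i \<notin> T"
    using assms(2) by (auto simp: facets_at_def)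
  moreover have "F \<in> \<Delta>" using assms(2) by (simp add: facets_at_def facets_def)
  ultimately show "T \<in> link \<Delta> i"
    using assms(1) by (simp add: simplicial_complex_def link_def)
qed

lemma restrict_game:
  assumes "v \<in> games \<Delta>"
  shows "restrict v (Pow F) \<in> games (Pow F)"
  using assms by (auto simp: games_def)

text \<open>Double counting over the pairs (T, F) with T contained in F - {i}. Both directions use
  it twice: with \<open>g\<close> constantly 1 to compare total masses, and with \<open>g\<close>
  the marginal contributions to compare values.\<close>

lemma sum_link_eq_sum_facets_at:
  fixes a :: "nat set \<Rightarrow> nat set \<Rightarrow> real"
  assumes "simplicial_complex n \<Delta>"
  shows "(\<Sum>T\<in>link \<Delta> i. (\<Sum>F\<in>{F \<in> facets_at \<Delta> i. T \<in> Pow (F - {i})}. a F T) * g T) =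
    (\<Sum>F\<in>facets_at \<Delta> i. \<Sum>T\<in>Pow (F - {i}). a F T * g T)"
proof -
  have fin: "finite (link \<Delta> i)" "finite (facets_at \<Delta> i)"
    using finite_simplicial_complex[OF assms] by (simp_all add: link_def finite_facets_at)
  have "(\<Sum>T\<in>link \<Delta> i. (\<Sum>F\<in>{F \<in> facets_at \<Delta> i. T \<in> Pow (F - {i})}. a F T) * g T) =
    (\<Sum>T\<in>link \<Delta> i. \<Sum>F\<in>{F \<in> facets_at \<Delta> i. T \<in> Pow (F - {i})}. a F T * g T)"
    by (simp add: sum_distrib_right)
  also have "\<dots> = (\<Sum>F\<in>facets_at \<Delta> i. \<Sum>T\<in>{T \<in> link \<Delta> i. T \<in> Pow (F - {i})}. a F T * g T)"
    by (rule sum.swap_restrict[OF fin])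
  also have "\<dots> = (\<Sum>F\<in>facets_at \<Delta> i. \<Sum>T\<in>Pow (F - {i}). a F T * g T)"
  proof (rule sum.cong[OF refl])
    fix F assume "F \<in> facets_at \<Delta> i"
    \<comment> \<open>Subsets of F - {i} lie in the link automatically, so the restriction of the
      swapped sum to the link disappears.\<close>
    then have "{T \<in> link \<Delta> i. T \<in> Pow (F - {i})} = Pow (F - {i})"
      using Pow_facet_subset_link[OF assms] by blast
    then show "(\<Sum>T\<in>{T \<in> link \<Delta> i. T \<in> Pow (F - {i})}. a F T * g T) =
      (\<Sum>T\<in>Pow (F - {i}). a F T * g T)" by simp
  qed
  finally show ?thesis .
qed

lemma quasi_probabilistic_if_facet_mixture:
  fixes P :: "nat set \<Rightarrow> real"
  assumes sc: "simplicial_complex n \<Delta>"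
    and P: "\<And>F. F \<in> facets \<Delta> \<Longrightarrow> 0 \<le> P F" "(\<Sum>F\<in>facets \<Delta>. P F) = 1"
      "(\<Sum>F\<in>facets_at \<Delta> i. P F) = \<rho>"
    and \<psi>: "\<And>F. F \<in> facets_at \<Delta> i \<Longrightarrow> probabilistic_on_simplex F i (\<psi> F)"
    and \<phi>: "\<And>v. v \<in> games \<Delta> \<Longrightarrow>
      \<phi> v = (\<Sum>F\<in>facets_at \<Delta> i. P F * \<psi> F (restrict v (Pow F)))"
  shows "quasi_probabilistic \<Delta> i \<rho> \<phi>"
proof -
  have sub: "facets_at \<Delta> i \<subseteq> facets \<Delta>" by (auto simp: facets_at_def)
  have "\<forall>F\<in>facets_at \<Delta> i. \<exists>q :: nat set \<Rightarrow> real.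
      (\<forall>T\<in>Pow (F - {i}). 0 \<le> q T) \<and> (\<Sum>T\<in>Pow (F - {i}). q T) = 1 \<and>
      (\<forall>w\<in>games (Pow F). \<psi> F w = (\<Sum>T\<in>Pow (F - {i}). q T * (w (insert i T) - w T)))"
    using \<psi> by (simp add: probabilistic_on_simplex_def)
  from bchoice[OF this] obtain q :: "nat set \<Rightarrow> nat set \<Rightarrow> real"
    where q0: "\<And>F T. F \<in> facets_at \<Delta> i \<Longrightarrow> T \<in> Pow (F - {i}) \<Longrightarrow> 0 \<le> q F T"
      and q1: "\<And>F. F \<in> facets_at \<Delta> i \<Longrightarrow> (\<Sum>T\<in>Pow (F - {i}). q F T) = 1"
      and q\<psi>: "\<And>F w. F \<in> facets_at \<Delta> i \<Longrightarrow> w \<in> games (Pow F) \<Longrightarrow>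
        \<psi> F w = (\<Sum>T\<in>Pow (F - {i}). q F T * (w (insert i T) - w T))"
    by blast
  \<comment> \<open>The coefficient that the marginal contribution at T receives once the mixture is
    expanded and regrouped by T.\<close>
  define p where "p T = (\<Sum>F\<in>{F \<in> facets_at \<Delta> i. T \<in> Pow (F - {i})}. P F * q F T)" for T
  have "0 \<le> \<rho>" using P(1) sub unfolding P(3)[symmetric] by (intro sum_nonneg) auto
  moreover have "\<rho> \<le> 1"
    unfolding P(3)[symmetric] P(2)[symmetric]
    using sub P(1) finite_facets[OF finite_simplicial_complex[OF sc]] by (intro sum_mono2) auto
  moreover have "0 \<le> p T" for T
    unfolding p_def using q0 P(1) sub by (intro sum_nonneg mult_nonneg_nonneg) auto
  \<comment> \<open>For fixed F the weights \<open>q F T\<close> sum to 1, so only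
    \<open>P F\<close> remains after the exchange of sums.\<close>
  moreover have "(\<Sum>T\<in>link \<Delta> i. p T) = \<rho>"
    using sum_link_eq_sum_facets_at[OF sc, where i = i
        and a = "\<lambda>F T. P F * q F T" and g = "\<lambda>_. 1"]
    by (simp add: p_def sum_distrib_left[symmetric] q1 P(3))
  moreover have "\<phi> v = (\<Sum>T\<in>link \<Delta> i. p T * (v (insert i T) - v T))" if v: "v \<in> games \<Delta>" for v
  proof -
    have "P F * \<psi> F (restrict v (Pow F)) =
        (\<Sum>T\<in>Pow (F - {i}). P F * q F T * (v (insert i T) - v T))"
      if F: "F \<in> facets_at \<Delta> i" for F
    proof -
      have "i \<in> F" using F by (simp add: facets_at_def)
      \<comment> \<open>Since \<open>i\<close> is in F, both arguments are subsets of F, where the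
        restriction agrees with \<open>v\<close>.\<close>
      then have "restrict v (Pow F) (insert i T) - restrict v (Pow F) T = v (insert i T) - v T"
        if "T \<in> Pow (F - {i})" for T using that by auto
      then have "\<psi> F (restrict v (Pow F)) = (\<Sum>T\<in>Pow (F - {i}). q F T * (v (insert i T) - v T))"
        unfolding q\<psi>[OF F restrict_game[OF v]] by (intro sum.cong) (simp_all only:)
      then show ?thesis by (simp add: sum_distrib_left mult.assoc)
    qed
    then show ?thesis
      unfolding \<phi>[OF v] p_def sum_link_eq_sum_facets_at[OF sc] by (rule sum.cong[OF refl])
  qed
  ultimately show ?thesis
    unfolding quasi_probabilistic_def by (intro conjI exI[of _ p]) simp_all
qed

lemma facet_mixture_if_quasi_probabilistic:
  assumes sc: "simplicial_complex n \<Delta>"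
    and avoid: "\<rho> = 1 \<or> (\<exists>F\<in>facets \<Delta>. i \<notin> F)"
    and qp: "quasi_probabilistic \<Delta> i \<rho> \<phi>"
  obtains P :: "nat set \<Rightarrow> real" and \<psi>
  where "\<And>F. F \<in> facets \<Delta> \<Longrightarrow> 0 \<le> P F" "(\<Sum>F\<in>facets \<Delta>. P F) = 1"
    "(\<Sum>F\<in>facets_at \<Delta> i. P F) = \<rho>"
    "\<And>F. F \<in> facets_at \<Delta> i \<Longrightarrow> probabilistic_on_simplex F i (\<psi> F)"
    "\<And>v. v \<in> games \<Delta> \<Longrightarrow>
      \<phi> v = (\<Sum>F\<in>facets_at \<Delta> i. P F * \<psi> F (restrict v (Pow F)))"
proof -
  have fin: "finite (facets \<Delta>)" "finite (facets_at \<Delta> i)"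
    using finite_simplicial_complex[OF sc] by (simp_all add: finite_facets finite_facets_at)
  obtain p :: "nat set \<Rightarrow> real" where \<rho>: "0 \<le> \<rho>" "\<rho> \<le> 1"
    and p0: "\<And>T. T \<in> link \<Delta> i \<Longrightarrow> 0 \<le> p T" and p1: "(\<Sum>T\<in>link \<Delta> i. p T) = \<rho>"
    and p\<phi>: "\<And>v. v \<in> games \<Delta> \<Longrightarrow> \<phi> v = (\<Sum>T\<in>link \<Delta> i. p T * (v (insert i T) - v T))"
    using qp unfolding quasi_probabilistic_def by blast
  have "\<exists>F. F \<in> facets_at \<Delta> i \<and> T \<in> Pow (F - {i})" if "T \<in> link \<Delta> i" for T
  proof -
    have T: "i \<notin> T" "insert i T \<in> \<Delta>" using that by (auto simp: link_def)
    obtain F where "F \<in> facets \<Delta>" "insert i T \<subseteq> F"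
      using face_subset_facet[OF finite_simplicial_complex[OF sc] T(2)] .
    then show ?thesis using T(1) by (auto simp: facets_at_def)
  qed
  then obtain c where c: "\<And>T. T \<in> link \<Delta> i \<Longrightarrow> c T \<in> facets_at \<Delta> i \<and> T \<in> Pow (c T - {i})"
    by metis
  \<comment> \<open>When \<open>\<rho>\<close> = 1 nothing is known about \<open>F0\<close>, which
    is harmless because the mass 1 - \<open>\<rho>\<close> it would receive is then 0.\<close>
  obtain F0 where F0: "\<rho> = 1 \<or> F0 \<in> facets \<Delta> \<and> i \<notin> F0" using avoid by blast
  \<comment> \<open>The whole weight of T goes to the single facet \<open>c T\<close>, so no face is
    counted twice although it may lie in several facets.\<close>
  define a where "a F T = (if c T = F then p T else 0)" for F T
  define m where "m F = (\<Sum>T\<in>Pow (F - {i}). a F T)" for F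
  define P where "P F = (if i \<in> F then m F else if F = F0 then 1 - \<rho> else 0)" for F
  \<comment> \<open>If F collects no mass, normalising is impossible; the point mass at the empty
    coalition serves as a default probability distribution.\<close>
  define q where "q F T = (if m F = 0 then (if T = {} then 1 else 0) else a F T / m F)" for F T
  define \<psi> where "\<psi> F w = (\<Sum>T\<in>Pow (F - {i}). q F T * (w (insert i T) - w T))"
    for F and w :: "nat set \<Rightarrow> real"
  have a0: "0 \<le> a F T" if "F \<in> facets_at \<Delta> i" "T \<in> Pow (F - {i})" for F T
    using p0 Pow_facet_subset_link[OF sc that(1)] that(2) by (auto simp: a_def)
  have m0: "0 \<le> m F" if "F \<in> facets_at \<Delta> i" for F
    unfolding m_def using a0[OF that] by (rule sum_nonneg)
  \<comment> \<open>Exactly one term of the sum can be nonzero, the one for \<open>c T\<close>, and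
    the choice of \<open>c\<close> puts that facet in the index set.\<close>
  have sum_a: "(\<Sum>F\<in>{F \<in> facets_at \<Delta> i. T \<in> Pow (F - {i})}. a F T) = p T"
    if "T \<in> link \<Delta> i" for T
    using c[OF that] fin(2) by (simp add: a_def)
  have Pm: "P F = m F" if "F \<in> facets_at \<Delta> i" for F
    using that by (simp add: P_def facets_at_def)
  have sum_m: "(\<Sum>F\<in>facets_at \<Delta> i. m F) = \<rho>"
    using sum_link_eq_sum_facets_at[OF sc, where i = i and a = a and g = "\<lambda>_. 1"] sum_a
    by (simp add: m_def p1 cong: sum.cong)
  \<comment> \<open>This undoes the normalisation. It survives the default case: a vanishing sum of
    non-negative terms forces each \<open>a F T\<close> to be 0.\<close>
  have mq: "m F * q F T = a F T" if F: "F \<in> facets_at \<Delta> i" and T: "T \<in> Pow (F - {i})" for F T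
  proof (cases "m F = 0")
    case True
    have "finite (Pow (F - {i}))" using facets_at_finite_set[OF sc F] by simp
    then have "a F T = 0"
      using True a0[OF F] T sum_nonneg_eq_0_iff[of "Pow (F - {i})" "a F"] unfolding m_def by blast
    then show ?thesis using True by simp
  qed (simp add: q_def)
  show thesis
  proof (rule that[of P \<psi>])
    show "0 \<le> P F" if "F \<in> facets \<Delta>" for F
      using that m0 \<rho> by (simp add: P_def facets_at_def)
    show sum_P: "(\<Sum>F\<in>facets_at \<Delta> i. P F) = \<rho>"
      using sum_m by (simp add: Pm)
    have "(\<Sum>F\<in>facets \<Delta> - facets_at \<Delta> i. P F) =
        (\<Sum>F\<in>facets \<Delta> - facets_at \<Delta> i. if F = F0 then 1 - \<rho> else 0)"
      by (rule sum.cong) (auto simp: P_def facets_at_def)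
    \<comment> \<open>Either \<open>F0\<close> is one of the facets summed over, or
      \<open>\<rho>\<close> = 1 and both sides are 0.\<close>
    also have "\<dots> = 1 - \<rho>" using F0 fin by (auto simp: facets_at_def)
    finally show "(\<Sum>F\<in>facets \<Delta>. P F) = 1"
      using sum_P sum.subset_diff[of "facets_at \<Delta> i" "facets \<Delta>" P] fin
      by (simp add: facets_at_def)
    show "probabilistic_on_simplex F i (\<psi> F)" if F: "F \<in> facets_at \<Delta> i" for F
    proof -
      have finF: "finite F" and "i \<in> F"
        using F facets_at_finite_set[OF sc F] by (simp_all add: facets_at_def)
      moreover have "0 \<le> q F T" if "T \<in> Pow (F - {i})" for T
        using a0[OF F that] m0[OF F] by (simp add: q_def)
      moreover have "(\<Sum>T\<in>Pow (F - {i}). q F T) = 1"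
      proof (cases "m F = 0")
        case True
        then show ?thesis using finF by (simp add: q_def)
      next
        case False
        then have "(\<Sum>T\<in>Pow (F - {i}). q F T) = (\<Sum>T\<in>Pow (F - {i}). a F T) / m F"
          by (simp add: q_def sum_divide_distrib)
        then show ?thesis using False by (simp add: m_def[symmetric])
      qed
      ultimately show ?thesis unfolding probabilistic_on_simplex_def \<psi>_def by blast
    qed
    show "\<phi> v = (\<Sum>F\<in>facets_at \<Delta> i. P F * \<psi> F (restrict v (Pow F)))" if v: "v \<in> games \<Delta>" for v
    proof -
      have "P F * \<psi> F (restrict v (Pow F)) =
          (\<Sum>T\<in>Pow (F - {i}). a F T * (v (insert i T) - v T))"
        if F: "F \<in> facets_at \<Delta> i" for F
        unfolding Pm[OF F] \<psi>_def sum_distrib_left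
      proof (rule sum.cong[OF refl])
        fix T assume T: "T \<in> Pow (F - {i})"
        then have "insert i T \<subseteq> F" "T \<subseteq> F" using F by (auto simp: facets_at_def)
        then show "m F * (q F T * (restrict v (Pow F) (insert i T) - restrict v (Pow F) T)) =
            a F T * (v (insert i T) - v T)"
          using mq[OF F T] by (simp add: mult.assoc[symmetric])
      qed
      then have "(\<Sum>F\<in>facets_at \<Delta> i. P F * \<psi> F (restrict v (Pow F))) =
          (\<Sum>F\<in>facets_at \<Delta> i. \<Sum>T\<in>Pow (F - {i}). a F T * (v (insert i T) - v T))"
        by (rule sum.cong[OF refl])
      \<comment> \<open>The double count is read backwards here: regrouping by T reassembles the
        pieces \<open>a F T\<close> into \<open>p T\<close>.\<close>
      also have "\<dots> = (\<Sum>T\<in>link \<Delta> i. p T * (v (insert i T) - v T))"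
        unfolding sum_link_eq_sum_facets_at[OF sc, symmetric] using sum_a by (intro sum.cong) auto
      finally show ?thesis using p\<phi>[OF v] by simp
    qed
  qed
qed

text \<open>The last assumption secures a place for the mass 1 - \<open>\<rho>\<close>. By
  \<open>rate_eq_1_or_facet_avoiding\<close> it follows from the right-hand side, and
  \<open>quasi_probabilistic_without_facet_distribution\<close> shows that the forward implication
  fails without it.\<close>

theorem theorem2p2:
  fixes n i :: nat and \<Delta> :: "nat set set" and \<rho> :: real
    and \<phi> :: "(nat set \<Rightarrow> real) \<Rightarrow> real"
  assumes "simplicial_complex n \<Delta>"
    and "i \<in> {1..n}"
    and "\<rho> = 1 \<or> (\<exists>F\<in>facets \<Delta>. i \<notin> F)"
  shows "quasi_probabilistic \<Delta> i \<rho> \<phi> \<longleftrightarrow>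
    (\<exists>P :: nat set \<Rightarrow> real.
       (\<forall>F\<in>facets \<Delta>. 0 \<le> P F) \<and>
       (\<Sum>F\<in>facets \<Delta>. P F) = 1 \<and>
       (\<Sum>F\<in>facets_at \<Delta> i. P F) = \<rho> \<and>
       (\<exists>\<psi> :: nat set \<Rightarrow> (nat set \<Rightarrow> real) \<Rightarrow> real.
          (\<forall>F\<in>facets_at \<Delta> i. probabilistic_on_simplex F i (\<psi> F)) \<and>
          (\<forall>v\<in>games \<Delta>.
             \<phi> v = (\<Sum>F\<in>facets_at \<Delta> i. P F * \<psi> F (restrict v (Pow F))))))"
  (is "_ \<longleftrightarrow> ?mixture")
proof
  assume "quasi_probabilistic \<Delta> i \<rho> \<phi>"
  then show ?mixture
    by (rule facet_mixture_if_quasi_probabilistic[OF assms(1,3)]) blast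
next
  assume ?mixture
  then show "quasi_probabilistic \<Delta> i \<rho> \<phi>"
    by (elim exE conjE) (rule quasi_probabilistic_if_facet_mixture[OF assms(1)], simp_all)
qed

end
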